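(* Let $T$ be a continuous t-norm on $[0,1]$ and $L$ be a right continuous t-conorm on $[0,\infty]$. Then $L\otimes T(f,g)\in\mathcal{D}^+_c$ for all $f,g\in\mathcal{D}^+_c$ if and only if $L$ satisfies the condition (LS): for all $x,x',y,y'\in[0,\infty]$, if $x<x'$ and $y<y'$ then $L(x,y)<L(x',y')$. In this case, $(\mathcal{D}^+_c,L\otimes T)$ is a subsemigroup, but not a submonoid, of $(\Delta^+,L\otimes T)$, since the identity $\varepsilon(0,1)$ is not in $\mathcal{D}^+_c$.
   Context: A distance distribution function (d.d.f.) is an increasing (i.e. non-decreasing) function $f:[0,\infty]\to[0,1]$ with $f(0)=0$, $f(\infty)=1$ that is left continuous on the open interval $]0,\infty[$. $\Delta^+$ is the set of all d.d.f.'s, ordered pointwise; it is a complete lattice in which suprema of non-empty families are computed pointwise. $\mathcal{D}^+_c\subseteq\Delta^+$ is the set of all d.d.f.'s that are continuous on $[0,\infty]$. For $r\in[0,\infty]$, $p\in[0,1]$, the step function $\varepsilon(r,p)\in\Delta^+$ is given by $\varepsilon(r,p)(\infty)=1$, $\varepsilon(r,p)(x)=p$ for $r<x<\infty$, and $\varepsilon(r,p)(x)=0$ for $x\le r$, $x<\infty$. A t-norm $T$ is an associative, commutative binary operation on $[0,1]$, increasing in each place, with identity $1$; it is continuous if it is continuous as a function $[0,1]^2\to[0,1]$. A t-conorm $L$ on $[0,\infty]$ is an associative, commutative binary operation on $[0,\infty]$, increasing in each place, with identity $0$; it is right continuous if it is right continuous as a function $[0,\infty]^2\to[0,\infty]$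 (equivalently, it preserves arbitrary infima in each variable). $L\otimes T$ is the binary operation on $\Delta^+$ that preserves arbitrary suprema in each variable and satisfies $L\otimes T(\varepsilon(r,p),\varepsilon(s,q))=\varepsilon(L(r,s),T(p,q))$ for all $r,s,p,q$; equivalently $L\otimes T(f,g)=\sup_{r,s\in[0,\infty]}\varepsilon(L(r,s),T(f(r),g(s)))$ (supremum in $\Delta^+$). $(\Delta^+,L\otimes T)$ is a commutative monoid with identity $\varepsilon(0,1)$. *)

theory Defs
  imports "HOL-Analysis.Analysis" "HOL-Algebra.Group"
begin

text \<open>
  The interval from 0 to infinity is the type \<^typ>\<open>ennreal\<close>, whose topology is the order
  topology. The unit interval is the subset \<open>{0..1}\<close> of \<^typ>\<open>real\<close>; a t-norm is a binary
  function on the reals that is constrained, and only ever used, on that subset.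
\<close>

definition ddf :: "(ennreal \<Rightarrow> real) set" where
  "ddf = {f. range f \<subseteq> {0..1} \<and> mono f \<and> f 0 = 0 \<and> f \<infinity> = 1 \<and>
             (\<forall>x. 0 < x \<and> x < \<infinity> \<longrightarrow> continuous (at_left x) f)}"

definition continuous_ddf :: "(ennreal \<Rightarrow> real) set" where
  "continuous_ddf = {f \<in> ddf. continuous_on UNIV f}"

definition step_ddf :: "ennreal \<Rightarrow> real \<Rightarrow> ennreal \<Rightarrow> real" where
  "step_ddf r p x = (if x = \<infinity> then 1 else if x \<le> r then 0 else p)"

definition t_norm :: "(real \<Rightarrow> real \<Rightarrow> real) \<Rightarrow> bool" where
  "t_norm T \<longleftrightarrow>
     (\<forall>x\<in>{0..1}. \<forall>y\<in>{0..1}. T x y \<in> {0..1}) \<and>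
     (\<forall>x\<in>{0..1}. \<forall>y\<in>{0..1}. \<forall>z\<in>{0..1}. T (T x y) z = T x (T y z)) \<and>
     (\<forall>x\<in>{0..1}. \<forall>y\<in>{0..1}. T x y = T y x) \<and>
     (\<forall>x\<in>{0..1}. \<forall>x'\<in>{0..1}. \<forall>y\<in>{0..1}. \<forall>y'\<in>{0..1}.
        x \<le> x' \<longrightarrow> y \<le> y' \<longrightarrow> T x y \<le> T x' y') \<and>
     (\<forall>x\<in>{0..1}. T x 1 = x)"

definition continuous_t_norm :: "(real \<Rightarrow> real \<Rightarrow> real) \<Rightarrow> bool" where
  "continuous_t_norm T \<longleftrightarrow> t_norm T \<and> continuous_on ({0..1} \<times> {0..1}) (\<lambda>(x, y). T x y)"

definition t_conorm :: "(ennreal \<Rightarrow> ennreal \<Rightarrow> ennreal) \<Rightarrow> bool" where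
  "t_conorm L \<longleftrightarrow>
     (\<forall>x y z. L (L x y) z = L x (L y z)) \<and>
     (\<forall>x y. L x y = L y x) \<and>
     (\<forall>x x' y y'. x \<le> x' \<longrightarrow> y \<le> y' \<longrightarrow> L x y \<le> L x' y') \<and>
     (\<forall>x. L x 0 = x)"

text \<open>
  Right continuity is joint: the limit is taken over the upper right quadrant at each point.
\<close>

definition right_continuous_t_conorm :: "(ennreal \<Rightarrow> ennreal \<Rightarrow> ennreal) \<Rightarrow> bool" where
  "right_continuous_t_conorm L \<longleftrightarrow> t_conorm L \<and>
     (\<forall>x y. continuous (at (x, y) within {x..} \<times> {y..}) (\<lambda>(a, b). L a b))"

text \<open>
  The supremum in the lattice of d.d.f.'s of a non-empty family is pointwise, so
  \<open>tensor L T f g\<close> is the supremum there of the step functions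
  \<open>step_ddf (L r s) (T (f r) (g s))\<close>.
\<close>

definition tensor ::
  "(ennreal \<Rightarrow> ennreal \<Rightarrow> ennreal) \<Rightarrow> (real \<Rightarrow> real \<Rightarrow> real) \<Rightarrow>
   (ennreal \<Rightarrow> real) \<Rightarrow> (ennreal \<Rightarrow> real) \<Rightarrow> ennreal \<Rightarrow> real" where
  "tensor L T f g x = (SUP (r, s) \<in> UNIV. step_ddf (L r s) (T (f r) (g s)) x)"

definition ddf_monoid ::
  "(ennreal \<Rightarrow> ennreal \<Rightarrow> ennreal) \<Rightarrow> (real \<Rightarrow> real \<Rightarrow> real) \<Rightarrow> (ennreal \<Rightarrow> real) monoid" where
  "ddf_monoid L T = \<lparr>carrier = ddf, mult = tensor L T, one = step_ddf 0 1\<rparr>"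

text \<open>The locale \<^locale>\<open>submonoid\<close> without closure under the identity.\<close>

locale subsemigroup =
  fixes H and G (structure)
  assumes subset: "H \<subseteq> carrier G"
    and m_closed: "\<lbrakk>x \<in> H; y \<in> H\<rbrakk> \<Longrightarrow> x \<otimes> y \<in> H"

definition cond_LS :: "(ennreal \<Rightarrow> ennreal \<Rightarrow> ennreal) \<Rightarrow> bool" where
  "cond_LS L \<longleftrightarrow> (\<forall>x x' y y'. x < x' \<longrightarrow> y < y' \<longrightarrow> L x y < L x' y')"

text \<open>
  The remaining facts justify the definitions above: under the hypotheses on \<open>L\<close> and \<open>T\<close>, the
  operation is a commutative monoid operation on the d.d.f.'s with the stated identity, and it is
  the operation that preserves non-empty suprema and acts on step functions as prescribed.
\<close>

lemma ddf_D:
  assumes "f \<in> ddf"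
  shows "f x \<in> {0..1}" "mono f" "f 0 = 0" "f \<infinity> = 1"
  using assms unfolding ddf_def by blast+

lemma continuous_at_left_mono:
  fixes f :: "ennreal \<Rightarrow> real"
  assumes m: "mono f" and x: "0 < x" and a: "\<And>y. y < f x \<Longrightarrow> \<exists>u<x. y < f u"
  shows "continuous (at_left x) f"
  unfolding continuous_within
proof (rule order_tendstoI)
  fix y assume "y < f x"
  then obtain u where u: "u < x" "y < f u" using a by blast
  have "\<forall>z>u. z < x \<longrightarrow> y < f z" using u m by (meson less_imp_le monoD order_less_le_trans)
  then show "eventually (\<lambda>z. y < f z) (at_left x)"
    using u x by (auto simp: eventually_at_left[OF x])
next
  fix y assume y: "f x < y"
  have "\<forall>z>0. z < x \<longrightarrow> f z < y" using y m by (meson less_imp_le monoD order_le_less_trans)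
  then show "eventually (\<lambda>z. f z < y) (at_left x)"
    using x by (auto simp: eventually_at_left[OF x])
qed

lemma ddf_approx:
  assumes f: "f \<in> ddf" and x: "0 < x" "x \<noteq> \<infinity>" and y: "y < f x"
  shows "\<exists>u<x. y < f u"
proof -
  have "continuous (at_left x) f" using f x by (auto simp: ddf_def top.not_eq_extremum)
  then have "(f \<longlongrightarrow> f x) (at_left x)" by (simp add: continuous_within)
  then have "eventually (\<lambda>z. y < f z) (at_left x)" using y by (rule order_tendstoD)
  then obtain b where "b < x" "\<forall>z>b. z < x \<longrightarrow> y < f z"
    using x by (auto simp: eventually_at_left[OF x(1)])
  then show ?thesis by (meson dense)
qed

lemma step_ddf_in_ddf:
  assumes "p \<in> {0..1}"
  shows "step_ddf r p \<in> ddf"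
proof -
  have m: "mono (step_ddf r p)"
    using assms by (auto simp: mono_def step_ddf_def top.extremum_unique)
  have "continuous (at_left x) (step_ddf r p)" if x: "0 < x" "x < \<infinity>" for x
  proof (rule continuous_at_left_mono[OF m x(1)])
    fix y assume y: "y < step_ddf r p x"
    show "\<exists>u<x. y < step_ddf r p u"
    proof (cases "x \<le> r")
      case True
      then show ?thesis using x y less_imp_neq[OF x(2)] by (intro exI[of _ 0]) (simp add: step_ddf_def)
    next
      case False
      then obtain u where "r < u" "u < x" using dense[of r x] by (auto simp: not_le)
      then show ?thesis using x y False less_imp_neq[OF x(2)] by (auto simp: step_ddf_def intro!: exI[of _ u])
    qed
  qed
  then show ?thesis using m assms by (auto simp: ddf_def) (auto simp: step_ddf_def)
qed

context
  fixes L T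
  assumes T: "continuous_t_norm T" and L: "right_continuous_t_conorm L"
begin

lemma T_range: "x \<in> {0..1} \<Longrightarrow> y \<in> {0..1} \<Longrightarrow> T x y \<in> {0..1}"
  and T_assoc: "x \<in> {0..1} \<Longrightarrow> y \<in> {0..1} \<Longrightarrow> z \<in> {0..1} \<Longrightarrow> T (T x y) z = T x (T y z)"
  and T_comm: "x \<in> {0..1} \<Longrightarrow> y \<in> {0..1} \<Longrightarrow> T x y = T y x"
  and T_mono: "x \<in> {0..1} \<Longrightarrow> x' \<in> {0..1} \<Longrightarrow> y \<in> {0..1} \<Longrightarrow> y' \<in> {0..1} \<Longrightarrow>
    x \<le> x' \<Longrightarrow> y \<le> y' \<Longrightarrow> T x y \<le> T x' y'"
  and T_one: "x \<in> {0..1} \<Longrightarrow> T x 1 = x"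
  using T unfolding continuous_t_norm_def t_norm_def by blast+

lemma T_zero: "x \<in> {0..1} \<Longrightarrow> T 0 x = 0"
  using T_mono[of 0 0 x 1] T_one[of 0] T_range[of 0 x] by auto

lemma T_sup:
  assumes a: "a \<in> {0..1}" "b \<in> {0..1}" and c: "0 \<le> c"
    and le: "\<And>a'. 0 \<le> a' \<Longrightarrow> a' < a \<Longrightarrow> T a' b \<le> c"
  shows "T a b \<le> c"
proof (cases "a = 0")
  case True
  then show ?thesis using T_zero a c by simp
next
  case False
  then have a0: "0 < a" using a by simp
  have "continuous_on {0..1} (\<lambda>t. (\<lambda>(x, y). T x y) (t, b))"
    by (rule continuous_on_compose2[of "{0..1} \<times> {0..1}" "\<lambda>(x, y). T x y" "{0..1}" "\<lambda>t. (t, b)"])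
       (use T a in \<open>auto simp: continuous_t_norm_def intro!: continuous_intros\<close>)
  then have "continuous_on {0..1} (\<lambda>t. T t b)" by simp
  then have "((\<lambda>t. T t b) \<longlongrightarrow> T a b) (at a within {0..1})" using a by (simp add: continuous_on_def)
  then have "((\<lambda>t. T t b) \<longlongrightarrow> T a b) (at a within {0..<a})"
    by (rule tendsto_within_subset) (use a in auto)
  moreover have "eventually (\<lambda>t. T t b \<le> c) (at a within {0..<a})"
    by (auto simp: eventually_at_filter intro!: always_eventually le)
  moreover have "at a within {0..<a} \<noteq> bot"
    using a0 by (simp add: at_within_eq_bot_iff trivial_limit_within islimpt_Ico)
  ultimately show ?thesis using tendsto_upperbound by blast
qed

lemma L_assoc: "L (L x y) z = L x (L y z)"
  and L_comm: "L x y = L y x"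
  and L_mono: "x \<le> x' \<Longrightarrow> y \<le> y' \<Longrightarrow> L x y \<le> L x' y'"
  and L_zero: "L x 0 = x"
  using L unfolding right_continuous_t_conorm_def t_conorm_def by blast+

lemma L_ge: "x \<le> L x y" "y \<le> L x y"
  using L_mono[of x x 0 y] L_mono[of y y 0 x] L_zero[of x] L_zero[of y] L_comm[of y x] by auto

lemma L_right:
  assumes "L r s < x"
  shows "\<exists>r'>r. \<exists>s'>s. L r' s' < x"
proof -
  have fin: "r < \<infinity>" "s < \<infinity>" using L_ge[of r s] L_ge(2)[of s r] assms
    by (auto simp: less_top[symmetric] top_unique)
  have "continuous (at (r, s) within {r..} \<times> {s..}) (\<lambda>(a, b). L a b)"
    using L by (auto simp: right_continuous_t_conorm_def)
  then have "((\<lambda>(a, b). L a b) \<longlongrightarrow> L r s) (at (r, s) within {r..} \<times> {s..})"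
    by (simp add: continuous_within)
  then have "eventually (\<lambda>(a, b). L a b < x) (at (r, s) within {r..} \<times> {s..})"
    using order_tendstoD(2)[OF _ assms] by (simp add: case_prod_unfold)
  then obtain S where S: "open S" "(r, s) \<in> S"
    "\<And>z. z \<in> S \<Longrightarrow> z \<noteq> (r, s) \<Longrightarrow> z \<in> {r..} \<times> {s..} \<Longrightarrow> (\<lambda>(a, b). L a b < x) z"
    unfolding eventually_at_topological by blast
  obtain A B where AB: "open A" "open B" "(r, s) \<in> A \<times> B" "A \<times> B \<subseteq> S"
    using S(1,2) by (rule open_prod_elim)
  obtain b where b: "r < b" "{r..<b} \<subseteq> A" using open_right[OF AB(1)] AB(3) fin by blast
  obtain d where d: "s < d" "{s..<d} \<subseteq> B" using open_right[OF AB(2)] AB(3) fin by blast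
  obtain r' s' where rs: "r < r'" "r' < b" "s < s'" "s' < d" using b d dense by metis
  have "r' \<in> {r..<b}" "s' \<in> {s..<d}" using rs by auto
  then have "(r', s') \<in> S" using b(2) d(2) AB(4) by blast
  then have "L r' s' < x" using S(3)[of "(r', s')"] rs(1,3) less_imp_le[OF rs(1)] less_imp_le[OF rs(3)] by (simp add: less_imp_neq[OF rs(1), symmetric])
  then show ?thesis using rs by blast
qed

lemma tensor_bdd:
  assumes "f \<in> ddf" "g \<in> ddf"
  shows "step_ddf (L r s) (T (f r) (g s)) x \<in> {0..1}"
  using T_range[OF ddf_D(1)[OF assms(1)] ddf_D(1)[OF assms(2)]] by (auto simp: step_ddf_def)

lemma tensor_bdd_above:
  assumes "f \<in> ddf" "g \<in> ddf"
  shows "bdd_above (range (\<lambda>(r, s). step_ddf (L r s) (T (f r) (g s)) x))"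
  using tensor_bdd[OF assms] by (intro bdd_aboveI[of _ 1]) auto

lemma tensor_upper:
  assumes "f \<in> ddf" "g \<in> ddf" "L r s < x" "x \<noteq> \<infinity>"
  shows "T (f r) (g s) \<le> tensor L T f g x"
proof -
  have "T (f r) (g s) = (\<lambda>(r, s). step_ddf (L r s) (T (f r) (g s)) x) (r, s)"
    using assms by (simp add: step_ddf_def)
  also have "\<dots> \<le> tensor L T f g x"
    unfolding tensor_def by (rule cSUP_upper[OF UNIV_I tensor_bdd_above[OF assms(1,2)]])
  finally show ?thesis .
qed

lemma tensor_least:
  assumes "x \<noteq> \<infinity>" "0 \<le> c" "\<And>r s. L r s < x \<Longrightarrow> T (f r) (g s) \<le> c"
  shows "tensor L T f g x \<le> c"
  unfolding tensor_def by (rule cSUP_least) (use assms in \<open>auto simp: step_ddf_def\<close>)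

lemma tensor_top: "tensor L T f g \<infinity> = 1"
  by (simp add: tensor_def step_ddf_def)

lemma tensor_nonneg:
  assumes "f \<in> ddf" "g \<in> ddf"
  shows "0 \<le> tensor L T f g x"
proof -
  have "0 \<le> (\<lambda>(r, s). step_ddf (L r s) (T (f r) (g s)) x) (0, 0)"
    using tensor_bdd[OF assms] by auto
  also have "\<dots> \<le> tensor L T f g x"
    unfolding tensor_def by (rule cSUP_upper[OF UNIV_I tensor_bdd_above[OF assms]])
  finally show ?thesis .
qed

lemma tensor_le_1:
  assumes "f \<in> ddf" "g \<in> ddf"
  shows "tensor L T f g x \<le> 1"
  unfolding tensor_def by (rule cSUP_least) (use tensor_bdd[OF assms] in auto)

lemma tensor_approx:
  assumes "x \<noteq> \<infinity>" "0 \<le> y" "y < tensor L T f g x"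
  shows "\<exists>r s. L r s < x \<and> y < T (f r) (g s)"
  using tensor_least[of x y f g] assms by force

lemma tensor_in_ddf:
  assumes "f \<in> ddf" "g \<in> ddf"
  shows "tensor L T f g \<in> ddf"
proof -
  note nn = tensor_nonneg[OF assms] and le1 = tensor_le_1[OF assms]
  have m: "mono (tensor L T f g)"
  proof (rule monoI)
    fix x y :: ennreal assume xy: "x \<le> y"
    show "tensor L T f g x \<le> tensor L T f g y"
    proof (cases "y = \<infinity>")
      case True
      then show ?thesis using le1 tensor_top by simp
    next
      case False
      then have "x \<noteq> \<infinity>" using xy top_unique by auto
      then show ?thesis
        using nn False xy by (intro tensor_least tensor_upper assms) auto
    qed
  qed
  have z: "tensor L T f g 0 = 0"
    by (rule antisym[OF tensor_least nn]) auto
  have "continuous (at_left x) (tensor L T f g)" if x: "0 < x" "x < \<infinity>" for x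
  proof (rule continuous_at_left_mono[OF m x(1)])
    fix y assume y: "y < tensor L T f g x"
    show "\<exists>u<x. y < tensor L T f g u"
    proof (cases "0 \<le> y")
      case True
      then obtain r s where rs: "L r s < x" "y < T (f r) (g s)"
        using tensor_approx[of x y f g] x y by auto
      then obtain u where u: "L r s < u" "u < x" using dense by blast
      then have "T (f r) (g s) \<le> tensor L T f g u" using x by (intro tensor_upper assms) auto
      then show ?thesis using rs u by force
    next
      case False
      then show ?thesis using x z by (intro exI[of _ 0]) auto
    qed
  qed
  then show ?thesis using m z nn le1 tensor_top by (auto simp: ddf_def)
qed

lemma tensor_comm_le:
  assumes "f \<in> ddf" "g \<in> ddf"
  shows "tensor L T f g x \<le> tensor L T g f x"
proof (cases "x = \<infinity>")
  case False
  show ?thesis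
  proof (rule tensor_least[OF False tensor_nonneg[OF assms(2,1)]])
    fix r s assume "L r s < x"
    then show "T (f r) (g s) \<le> tensor L T g f x"
      using tensor_upper[OF assms(2,1), of s r x] False T_comm ddf_D(1) assms
      by (metis L_comm)
  qed
qed (simp add: tensor_top del: infinity_ennreal_def)

lemma tensor_comm:
  assumes "f \<in> ddf" "g \<in> ddf"
  shows "tensor L T f g = tensor L T g f"
  using tensor_comm_le assms by (intro ext antisym) auto

lemma tensor_one:
  assumes f: "f \<in> ddf"
  shows "tensor L T f (step_ddf 0 1) = f"
proof
  fix x
  have e: "step_ddf 0 1 \<in> ddf" by (simp add: step_ddf_in_ddf)
  show "tensor L T f (step_ddf 0 1) x = f x"
  proof (cases "x = \<infinity>")
    case True
    then show ?thesis using tensor_top ddf_D(4)[OF f] by simp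
  next
    case x: False
    have f0: "0 \<le> f x" for x using ddf_D(1)[OF f] by simp
    have "tensor L T f (step_ddf 0 1) x \<le> f x"
    proof (rule tensor_least[OF x f0])
      fix r s assume "L r s < x"
      then have "r \<le> x" using L_ge(1)[of r s] by simp
      have "T (f r) (step_ddf 0 1 s) \<le> T (f r) 1"
        using ddf_D(1)[OF f] ddf_D(1)[OF e, of s] by (intro T_mono) auto
      also have "\<dots> = f r" using ddf_D(1)[OF f] T_one by blast
      also have "\<dots> \<le> f x" using ddf_D(2)[OF f] \<open>r \<le> x\<close> by (rule monoD)
      finally show "T (f r) (step_ddf 0 1 s) \<le> f x" .
    qed
    moreover have "f x \<le> tensor L T f (step_ddf 0 1) x"
    proof (cases "x = 0")
      case True
      then show ?thesis using ddf_D(3)[OF f] tensor_nonneg[OF f e] by simp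
    next
      case False
      show ?thesis
      proof (rule dense_le)
        fix y assume "y < f x"
        then obtain u where u: "u < x" "y < f u" using ddf_approx[OF f _ x] False by (auto simp: zero_less_iff_neq_zero)
        have "L u 0 < x" using u L_zero by simp
        then obtain u' s' where us: "u < u'" "0 < s'" "L u' s' < x" using L_right by blast
        have "y \<le> f u'" using u(2) monoD[OF ddf_D(2)[OF f] less_imp_le[OF us(1)]] by simp
        also have "\<dots> = T (f u') (step_ddf 0 1 s')"
          using us(2) ddf_D(1)[OF f] T_one[of "f u'"] by (simp add: step_ddf_def not_le[symmetric])
        also have "\<dots> \<le> tensor L T f (step_ddf 0 1) x" by (rule tensor_upper[OF f e us(3) x])
        finally show "y \<le> tensor L T f (step_ddf 0 1) x" .
      qed
    qed
    ultimately show ?thesis by simp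
  qed
qed

lemma tensor_assoc_le:
  assumes f: "f \<in> ddf" and g: "g \<in> ddf" and h: "h \<in> ddf"
  shows "tensor L T (tensor L T f g) h x \<le> tensor L T f (tensor L T g h) x"
proof (cases "x = \<infinity>")
  case x: False
  note fg = tensor_in_ddf[OF f g] and gh = tensor_in_ddf[OF g h]
  note rf = ddf_D(1)[OF f] and rg = ddf_D(1)[OF g] and rh = ddf_D(1)[OF h]
    and rfg = ddf_D(1)[OF fg] and rgh = ddf_D(1)[OF gh]
  note nn = tensor_nonneg[OF f gh]
  show ?thesis
  proof (rule tensor_least[OF x nn])
    fix u t assume ut: "L u t < x"
    then have u: "u \<noteq> \<infinity>" using L_ge(1)[of u t] x by (auto simp: top_unique)
    show "T (tensor L T f g u) (h t) \<le> tensor L T f (tensor L T g h) x"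
    proof (rule T_sup[OF rfg rh nn])
      fix a assume a: "0 \<le> a" "a < tensor L T f g u"
      then obtain r s where rs: "L r s < u" "a < T (f r) (g s)" using tensor_approx u by blast
      have a1: "a \<in> {0..1}" using a rfg[of u] by auto
      have "L r (L s t) \<le> L u t" using L_mono[of "L r s" u t t] rs L_assoc by simp
      then have "L r (L s t) < x" using ut by simp
      then obtain r' v where v: "r < r'" "L s t < v" "L r' v < x" using L_right by blast
      have rv: "L r v < x" using L_mono[OF less_imp_le[OF v(1)] order_refl, of v] v(3) by (rule order_le_less_trans)
      then have v1: "v \<noteq> \<infinity>" using L_ge(2)[of v r] x by (auto simp: top_unique)
      have "T a (h t) \<le> T (T (f r) (g s)) (h t)"
        using rs by (intro T_mono a1 T_range rf rg rh) auto
      also have "\<dots> = T (f r) (T (g s) (h t))" by (intro T_assoc rf rg rh)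
      also have "\<dots> \<le> T (f r) (tensor L T g h v)"
        by (intro T_mono T_range rf rg rh rgh tensor_upper[OF g h v(2) v1]) simp
      also have "\<dots> \<le> tensor L T f (tensor L T g h) x" by (rule tensor_upper[OF f gh rv x])
      finally show "T a (h t) \<le> tensor L T f (tensor L T g h) x" .
    qed
  qed
qed (simp add: tensor_top del: infinity_ennreal_def)

lemma tensor_assoc:
  assumes f: "f \<in> ddf" and g: "g \<in> ddf" and h: "h \<in> ddf"
  shows "tensor L T (tensor L T f g) h = tensor L T f (tensor L T g h)"
proof (intro ext antisym)
  fix x
  show "tensor L T (tensor L T f g) h x \<le> tensor L T f (tensor L T g h) x"
    by (rule tensor_assoc_le[OF assms])
  have "tensor L T f (tensor L T g h) = tensor L T (tensor L T h g) f"
    using tensor_comm[OF f tensor_in_ddf[OF g h]] tensor_comm[OF g h] by simp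
  moreover have "tensor L T (tensor L T f g) h = tensor L T h (tensor L T g f)"
    using tensor_comm[OF tensor_in_ddf[OF f g] h] tensor_comm[OF f g] by simp
  ultimately show "tensor L T f (tensor L T g h) x \<le> tensor L T (tensor L T f g) h x"
    using tensor_assoc_le[OF h g f] by simp
qed

lemma comm_monoid_ddf_monoid: "comm_monoid (ddf_monoid L T)"
  by (rule comm_monoidI)
     (auto simp: ddf_monoid_def tensor_in_ddf step_ddf_in_ddf tensor_assoc tensor_one
        tensor_comm[of "step_ddf 0 1"] intro: tensor_comm)

lemma tensor_step_ddf:
  assumes p: "p \<in> {0..1}" and q: "q \<in> {0..1}"
  shows "tensor L T (step_ddf r p) (step_ddf s q) = step_ddf (L r s) (T p q)"
proof
  fix x
  note e = step_ddf_in_ddf[OF p, of r] step_ddf_in_ddf[OF q, of s]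
  note nn = ddf_D(1)[OF step_ddf_in_ddf[OF T_range[OF p q]], of "L r s" x]
  show "tensor L T (step_ddf r p) (step_ddf s q) x = step_ddf (L r s) (T p q) x"
  proof (cases "x = \<infinity>")
    case True
    then show ?thesis using tensor_top by (simp add: step_ddf_def)
  next
    case x: False
    show ?thesis
    proof (rule antisym)
      show "tensor L T (step_ddf r p) (step_ddf s q) x \<le> step_ddf (L r s) (T p q) x"
      proof (rule tensor_least[OF x])
        fix a b assume ab: "L a b < x"
        have fin: "a \<noteq> \<infinity>" "b \<noteq> \<infinity>"
          using ab L_ge(1)[of a b] L_ge(2)[of b a] x by (auto simp: top_unique)
        show "T (step_ddf r p a) (step_ddf s q b) \<le> step_ddf (L r s) (T p q) x"
        proof (cases "a \<le> r \<or> b \<le> s")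
          case True
          then have "step_ddf r p a = 0 \<or> step_ddf s q b = 0" using fin by (auto simp: step_ddf_def)
          then have "T (step_ddf r p a) (step_ddf s q b) = 0"
            using T_zero T_comm ddf_D(1)[OF e(1)] ddf_D(1)[OF e(2)] by metis
          then show ?thesis using nn by simp
        next
          case False
          then have "L r s < x" using L_mono[of r a s b] ab by (meson linear order_le_less_trans)
          then show ?thesis using False fin x by (auto simp: step_ddf_def)
        qed
      qed (use nn in simp)
      show "step_ddf (L r s) (T p q) x \<le> tensor L T (step_ddf r p) (step_ddf s q) x"
      proof (cases "L r s < x")
        case True
        then obtain a b where ab: "r < a" "s < b" "L a b < x" using L_right by blast
        then have fin: "a \<noteq> \<infinity>" "b \<noteq> \<infinity>"
          using L_ge(1)[of a b] L_ge(2)[of b a] x by (auto simp: top_unique)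
        have "T (step_ddf r p a) (step_ddf s q b) = step_ddf (L r s) (T p q) x"
          using ab fin x True by (auto simp: step_ddf_def)
        then show ?thesis using tensor_upper[OF e ab(3) x] by simp
      next
        case False
        then show ?thesis using x tensor_nonneg[OF e] by (simp add: step_ddf_def not_less)
      qed
    qed
  qed
qed

lemma tensor_SUP:
  assumes F: "F \<subseteq> ddf" "F \<noteq> {}" and g: "g \<in> ddf" and S: "(\<lambda>x. SUP f\<in>F. f x) \<in> ddf"
  shows "tensor L T (\<lambda>x. SUP f\<in>F. f x) g x = (SUP f\<in>F. tensor L T f g x)"
proof -
  have bF: "bdd_above ((\<lambda>f. f x) ` F)" for x
    using F(1) ddf_D(1) by (intro bdd_aboveI[of _ 1]) fastforce
  have bt: "bdd_above ((\<lambda>f. tensor L T f g x) ` F)"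
    using F(1) g tensor_le_1 by (intro bdd_aboveI[of _ 1]) blast
  note rS = ddf_D(1)[OF S] and rg = ddf_D(1)[OF g]
  have up: "tensor L T f g x \<le> (SUP f\<in>F. tensor L T f g x)" if "f \<in> F" for f
    using cSUP_upper[OF that bt] .
  obtain f0 where f0: "f0 \<in> F" using F by blast
  then have nn: "0 \<le> (SUP f\<in>F. tensor L T f g x)"
    using up[OF f0] tensor_nonneg[of f0 g x] F(1) g by fastforce
  show ?thesis
  proof (cases "x = \<infinity>")
    case True
    then show ?thesis using F(2) tensor_top by simp
  next
    case x: False
    show ?thesis
    proof (rule antisym)
      show "tensor L T (\<lambda>x. SUP f\<in>F. f x) g x \<le> (SUP f\<in>F. tensor L T f g x)"
      proof (rule tensor_least[OF x nn])
        fix r s assume rs: "L r s < x"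
        show "T (SUP f\<in>F. f r) (g s) \<le> (SUP f\<in>F. tensor L T f g x)"
        proof (rule T_sup[OF rS rg nn])
          fix a assume a: "0 \<le> a" "a < (SUP f\<in>F. f r)"
          then obtain f where f: "f \<in> F" "a < f r" using less_cSUP_iff[OF F(2) bF] by blast
          then have fd: "f \<in> ddf" using F by blast
          have a1: "a \<in> {0..1}" using a rS[of r] by auto
          have "T a (g s) \<le> T (f r) (g s)"
            using f by (intro T_mono a1 ddf_D(1)[OF fd] rg) auto
          also have "\<dots> \<le> tensor L T f g x" by (rule tensor_upper[OF fd g rs x])
          also have "\<dots> \<le> (SUP f\<in>F. tensor L T f g x)" by (rule up[OF f(1)])
          finally show "T a (g s) \<le> (SUP f\<in>F. tensor L T f g x)" .
        qed
      qed
      show "(SUP f\<in>F. tensor L T f g x) \<le> tensor L T (\<lambda>x. SUP f\<in>F. f x) g x"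
      proof (rule cSUP_least[OF F(2)])
        fix f assume f: "f \<in> F"
        then have fd: "f \<in> ddf" using F by blast
        show "tensor L T f g x \<le> tensor L T (\<lambda>x. SUP f\<in>F. f x) g x"
        proof (rule tensor_least[OF x tensor_nonneg[OF S g]])
          fix r s assume rs: "L r s < x"
          have "T (f r) (g s) \<le> T (SUP f\<in>F. f r) (g s)"
            by (intro T_mono ddf_D(1)[OF fd] rS rg cSUP_upper[OF f bF]) simp
          also have "\<dots> \<le> tensor L T (\<lambda>x. SUP f\<in>F. f x) g x" by (rule tensor_upper[OF S g rs x])
          finally show "T (f r) (g s) \<le> tensor L T (\<lambda>x. SUP f\<in>F. f x) g x" .
        qed
      qed
    qed
  qed
qed

end

end

theory Submission
  imports Defs
begin

text \<open>
  Write \<open>h\<close> for \<open>tensor L T f g\<close>; away from \<open>\<infinity>\<close>, \<open>h x\<close> is the supremum of \<open>T (f r) (g s)\<close> over all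
  \<open>(r, s)\<close> with \<open>L r s < x\<close>. Since \<open>h\<close> is already a d.d.f., continuity of \<open>h\<close> means continuity from
  the right at finite points and \<open>h x \<rightarrow> 1\<close> as \<open>x \<rightarrow> \<infinity>\<close>.

  Suppose that \<open>L\<close> satisfies (LS), and that \<open>f\<close> and \<open>g\<close> are continuous. If \<open>h\<close> stayed above some
  \<open>c > h x\<close> to the right of \<open>x\<close>, there would be pairs \<open>(r\<^sub>n, s\<^sub>n)\<close> with \<open>T (f r\<^sub>n) (g s\<^sub>n) > c\<close> and
  \<open>L r\<^sub>n s\<^sub>n < u\<^sub>n\<close>, where \<open>u\<^sub>n\<close> tends to \<open>x\<close> from above. By compactness of the extended half-line, pass
  to a limit \<open>(r, s)\<close>, where \<open>T (f r) (g s) \<ge> c\<close>. The operation \<open>L\<close> need not be continuous from the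
  left, but monotonicity gives \<open>L a b \<le> x\<close> whenever \<open>a < r\<close> and \<open>b < s\<close>, and (LS) makes this
  inequality strict, because such a pair can be increased a little further. Hence
  \<open>T (f a) (g b) \<le> h x\<close> for these \<open>a, b\<close>, and letting \<open>a\<close>, \<open>b\<close> tend to \<open>r\<close>, \<open>s\<close> yields
  \<open>T (f r) (g s) \<le> h x < c\<close>, a contradiction. At \<open>\<infinity>\<close>, (LS) ensures that \<open>L r s\<close> is finite for finite
  \<open>r, s\<close>, so \<open>h\<close> eventually exceeds every \<open>T (f r) (g s)\<close>, and these tend to \<open>T 1 1 = 1\<close>.

  Conversely, suppose that (LS) fails, so \<open>x < x'\<close>, \<open>y < y'\<close> and \<open>L x' y' \<le> L x y\<close>. Choose
  continuous ramps \<open>f\<close>, rising from 0 to 1 on \<open>{x..x'}\<close>, and \<open>g\<close>, doing so on \<open>{y..y'}\<close>. Then \<open>h\<close>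
  equals 0 at finite points up to \<open>L x y\<close> and 1 beyond, so it omits the value \<open>1/2\<close>. A
  continuous d.d.f. takes this value, by the intermediate value theorem. The same observation
  excludes the identity \<open>step_ddf 0 1\<close>.
\<close>

section \<open>Continuous distance distribution functions\<close>

lemma continuous_ddf_takes_half:
  assumes "f \<in> continuous_ddf"
  shows "\<exists>x. f x = 1/2"
proof -
  have f: "f \<in> ddf" "continuous_on UNIV f" using assms by (auto simp: continuous_ddf_def)
  have "\<exists>x\<ge>0. x \<le> \<infinity> \<and> f x = 1/2"
    by (rule IVT') (use ddf_D(3,4)[OF f(1)] f(2) in \<open>auto intro: continuous_on_subset\<close>)
  then show ?thesis by blast
qed

lemma step_ddf_one_not_continuous: "step_ddf r 1 \<notin> continuous_ddf"
proof
  assume "step_ddf r 1 \<in> continuous_ddf"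
  then obtain x where "step_ddf r 1 x = 1/2" using continuous_ddf_takes_half by blast
  then show False by (auto simp: step_ddf_def split: if_splits)
qed

text \<open>
  Left continuity is part of being a d.d.f. at finite points, so only two things remain: at
  \<open>\<infinity>\<close> the left limit must be 1, and at finite points there must be no jump to the right.
\<close>

lemma continuous_ddfI:
  assumes f: "f \<in> ddf"
    and top: "\<And>y. y < 1 \<Longrightarrow> \<exists>u<\<infinity>. y < f u"
    and right: "\<And>x y. x < \<infinity> \<Longrightarrow> f x < y \<Longrightarrow> \<exists>u>x. f u < y"
  shows "f \<in> continuous_ddf"
proof -
  note m = ddf_D(2)[OF f]
  have "continuous (at x) f" for x
    unfolding continuous_at_split
  proof
    show "continuous (at_left x) f"
    proof (cases "x = 0")
      case True
      then show ?thesis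
        using trivial_limit_at_left_bot[where 'a = ennreal] by (simp add: continuous_def bot_ennreal)
    next
      case False
      then have x: "0 < x" by (simp add: zero_less_iff_neq_zero)
      show ?thesis
      proof (rule continuous_at_left_mono[OF m x])
        fix y assume y: "y < f x"
        show "\<exists>u<x. y < f u"
        proof (cases "x = \<infinity>")
          case True
          then show ?thesis using top y ddf_D(4)[OF f] by simp
        next
          case False
          then show ?thesis using ddf_approx[OF f x _ y] by simp
        qed
      qed
    qed
    show "continuous (at_right x) f"
    proof (cases "x = \<infinity>")
      case True
      then show ?thesis
        using trivial_limit_at_right_top[where 'a = ennreal] by (simp add: continuous_def)
    next
      case False
      then have x: "x < \<infinity>" by (simp add: less_top)
      show ?thesis
        unfolding continuous_within
      proof (rule order_tendstoI)
        fix y assume y: "y < f x"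
        have "\<forall>z>x. y < f z" using y m by (meson less_imp_le monoD order_less_le_trans)
        then show "eventually (\<lambda>z. y < f z) (at_right x)"
          using x by (auto simp: eventually_at_right[OF x])
      next
        fix y assume "f x < y"
        then obtain u where u: "x < u" "f u < y" using right x by blast
        have "\<forall>z>x. z < u \<longrightarrow> f z < y" using u m by (meson less_imp_le monoD order_le_less_trans)
        then show "eventually (\<lambda>z. f z < y) (at_right x)"
          using u by (auto simp: eventually_at_right[OF x])
      qed
    qed
  qed
  then show ?thesis
    using f by (simp add: continuous_ddf_def continuous_at_imp_continuous_on)
qed

lemma continuous_ddf_ramp:
  fixes a b :: ennreal
  assumes ab: "a < b"
  shows "\<exists>f\<in>continuous_ddf. (\<forall>t\<le>a. f t = 0) \<and> (\<forall>t\<ge>b. f t = 1)"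
proof -
  \<comment> \<open>The bound \<open>b\<close> may be infinite, so the ramp ends at a finite \<open>c\<close> below it.\<close>
  obtain c where c: "a < c" "c < b" using dense[OF ab] by blast
  define e where "e t = enn2real (min t c)" for t
  have c_fin: "c < \<infinity>" using c(2) by (rule order_less_le_trans) simp
  have e_mono: "e s \<le> e t" if "s \<le> t" for s t
    unfolding e_def using that c_fin by (intro enn2real_mono) (auto simp: min_def)
  have e_a: "e a < e c"
    unfolding e_def using c c_fin by (cases a; cases c) (auto simp: ennreal_less_iff)
  define f where "f t = max 0 ((e t - e a) / (e c - e a))" for t
  have f_low: "f t = 0" if "t \<le> a" for t
    using e_mono[OF that] e_a by (simp add: f_def divide_nonpos_pos)
  have f_high: "f t = 1" if "c \<le> t" for t
    using that e_a by (simp add: f_def e_def min_absorb2)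
  have f_mono: "mono f"
    unfolding f_def using e_mono e_a
    by (intro monoI max.mono order_refl divide_right_mono diff_right_mono) auto
  have e_cont: "continuous_on UNIV e"
    unfolding e_def continuous_on_def
  proof
    fix t :: ennreal
    have "min t c < \<infinity>" using c_fin by (simp add: min_less_iff_disj)
    then have *: "min t c = ennreal (enn2real (min t c))" by simp
    have "((\<lambda>u. min u c) \<longlongrightarrow> min t c) (at t within UNIV)" by (intro tendsto_intros)
    then show "((\<lambda>u. enn2real (min u c)) \<longlongrightarrow> enn2real (min t c)) (at t within UNIV)"
      using * by (intro tendsto_enn2real) auto
  qed
  have f_cont: "continuous_on UNIV f"
    unfolding f_def using e_a by (intro continuous_intros e_cont) auto
  have f_range: "f t \<in> {0..1}" for t
    using monoD[OF f_mono, of 0 t] monoD[OF f_mono, of t \<infinity>] f_low[of 0] f_high[of \<infinity>] by auto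
  have "f \<in> ddf"
    unfolding ddf_def
  proof (clarsimp simp: f_mono f_low f_high, intro conjI allI impI)
    show "range f \<subseteq> {0..1}" using f_range by blast
    show "continuous (at_left t) f" for t
      using f_cont by (meson continuous_on_eq_continuous_within continuous_within_subset subset_UNIV UNIV_I)
  qed
  then have "f \<in> continuous_ddf" using f_cont by (simp add: continuous_ddf_def)
  moreover have "\<forall>t\<ge>b. f t = 1" using f_high c(2) by auto
  ultimately show ?thesis using f_low by blast
qed

lemma tendsto_t_norm_ddf:
  assumes T: "continuous_t_norm T"
    and fg: "f \<in> continuous_ddf" "g \<in> continuous_ddf"
    and ab: "(a \<longlongrightarrow> r) F" "(b \<longlongrightarrow> s) F"
  shows "((\<lambda>n. T (f (a n)) (g (b n))) \<longlongrightarrow> T (f r) (g s)) F"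
proof -
  have fg': "f \<in> ddf" "g \<in> ddf" "continuous_on UNIV f" "continuous_on UNIV g"
    using fg by (auto simp: continuous_ddf_def)
  have "((\<lambda>n. (f (a n), g (b n))) \<longlongrightarrow> (f r, g s)) F"
    using fg'(3,4) ab by (intro tendsto_Pair) (auto intro: continuous_on_tendsto_compose)
  moreover have "continuous_on ({0..1} \<times> {0..1}) (\<lambda>(x, y). T x y)"
    using T by (simp add: continuous_t_norm_def)
  moreover have "f t \<in> {0..1}" "g t \<in> {0..1}" for t
    using ddf_D(1) fg'(1,2) by blast+
  ultimately show ?thesis
    using continuous_on_tendsto_compose[of "{0..1} \<times> {0..1}" "\<lambda>(x, y). T x y"
        "\<lambda>n. (f (a n), g (b n))" "(f r, g s)" F] by simp
qed

section \<open>Condition (LS) suffices\<close>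

context
  fixes L T
  assumes T: "continuous_t_norm T" and L: "right_continuous_t_conorm L"
begin

text \<open>
  This is where (LS) replaces left continuity of \<open>L\<close>: a pair strictly below a limit of pairs with
  \<open>L r\<^sub>n s\<^sub>n < u\<^sub>n\<close>, with \<open>u\<^sub>n\<close> tending to \<open>x\<close>, lies strictly below level \<open>x\<close>.
\<close>

lemma LS_less_of_limit:
  assumes LS: "cond_LS L"
    and lim: "r \<longlonglongrightarrow> r0" "s \<longlonglongrightarrow> s0" "u \<longlonglongrightarrow> x"
    and less: "\<And>n. L (r n) (s n) < u n"
    and below: "a < r0" "b < s0"
  shows "L a b < x"
proof -
  obtain a' b' where ab: "a < a'" "a' < r0" "b < b'" "b' < s0"
    using dense[OF below(1)] dense[OF below(2)] by blast
  have "eventually (\<lambda>n. a' < r n \<and> b' < s n) sequentially"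
    using order_tendstoD(1)[OF lim(1) ab(2)] order_tendstoD(1)[OF lim(2) ab(4)]
    by eventually_elim simp
  then have "eventually (\<lambda>n. L a' b' \<le> u n) sequentially"
  proof eventually_elim
    case (elim n)
    then have "L a' b' \<le> L (r n) (s n)" by (intro L_mono[OF T L]) auto
    then show ?case using less[of n] by simp
  qed
  then have "L a' b' \<le> x" using tendsto_lowerbound[OF lim(3)] by simp
  then show ?thesis using LS ab unfolding cond_LS_def by (meson order_less_le_trans)
qed

text \<open>
  By continuity, the value at a pair with positive coordinates is a limit of values at pairs strictly
  below it. If a coordinate is 0 there are no such pairs, but then the value is 0.
\<close>

lemma t_norm_ddf_le_of_below:
  assumes fg: "f \<in> continuous_ddf" "g \<in> continuous_ddf" and c: "0 \<le> c"
    and le: "\<And>a b. a < r \<Longrightarrow> b < s \<Longrightarrow> T (f a) (g b) \<le> c"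
  shows "T (f r) (g s) \<le> c"
proof (cases "r = 0 \<or> s = 0")
  case True
  have fg': "f \<in> ddf" "g \<in> ddf" using fg by (auto simp: continuous_ddf_def)
  have "T (f r) (g s) = 0"
    using True ddf_D(1,3)[OF fg'(1)] ddf_D(1,3)[OF fg'(2)] T_zero[OF T L] T_comm[OF T L] by metis
  then show ?thesis using c by simp
next
  case False
  then have "0 < r" "0 < s" by (auto simp: zero_less_iff_neq_zero)
  then obtain a b where ab: "\<And>n. a n < r" "a \<longlonglongrightarrow> r" "\<And>n. b n < s" "b \<longlonglongrightarrow> s"
    by (metis approx_from_below_dense_linorder)
  show ?thesis
    by (rule LIMSEQ_le_const2[OF tendsto_t_norm_ddf[OF T fg ab(2,4)]]) (use le ab(1,3) in auto)
qed

lemma tensor_right_continuous: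
  assumes LS: "cond_LS L"
    and fg: "f \<in> continuous_ddf" "g \<in> continuous_ddf"
    and x: "x < \<infinity>" and y: "tensor L T f g x < y"
  shows "\<exists>u>x. tensor L T f g u < y"
proof (rule ccontr)
  assume "\<not> ?thesis"
  then have ge: "y \<le> tensor L T f g u" if "x < u" for u using that by force
  have fg': "f \<in> ddf" "g \<in> ddf" using fg by (auto simp: continuous_ddf_def)
  obtain c where c: "tensor L T f g x < c" "c < y" using dense[OF y] by blast
  have c0: "0 \<le> c" using tensor_nonneg[OF T L fg', of x] c(1) by simp
  obtain v where v: "x < v" "v < \<infinity>" using dense[OF x] by blast
  obtain w where w: "\<And>n. x < w n" "w \<longlonglongrightarrow> x"
    using approx_from_above_dense_linorder[OF v(1)] by blast
  \<comment> \<open>The tensor is described by pairs only at finite points, hence the cut-off at \<open>v\<close>.\<close>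
  define u where "u n = min (w n) v" for n
  have u: "x < u n" "u n \<noteq> \<infinity>" for n using w(1) v by (auto simp: u_def min_def)
  have "(\<lambda>n. min (w n) v) \<longlonglongrightarrow> min x v" by (intro tendsto_intros w(2))
  then have u_lim: "u \<longlonglongrightarrow> x" using v(1) by (simp add: u_def[abs_def] min_absorb1)
  have "\<exists>r s. L r s < u n \<and> c < T (f r) (g s)" for n
    using tensor_approx[OF T L u(2) c0] ge[OF u(1)] c(2) by (meson order_less_le_trans)
  then obtain r s where rs: "\<And>n. L (r n) (s n) < u n" "\<And>n. c < T (f (r n)) (g (s n))"
    by metis
  obtain r0 p where p: "strict_mono p" "(r \<circ> p) \<longlonglongrightarrow> r0"
    using compact_complete_linorder[of r] by blast
  obtain s0 q where q: "strict_mono q" "(s \<circ> p \<circ> q) \<longlonglongrightarrow> s0"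
    using compact_complete_linorder[of "s \<circ> p"] by blast
  have r_lim: "(r \<circ> p \<circ> q) \<longlonglongrightarrow> r0" using LIMSEQ_subseq_LIMSEQ[OF p(2) q(1)] .
  have u_lim': "(u \<circ> p \<circ> q) \<longlonglongrightarrow> x"
    using LIMSEQ_subseq_LIMSEQ[OF LIMSEQ_subseq_LIMSEQ[OF u_lim p(1)] q(1)] .
  have "c \<le> T (f r0) (g s0)"
    by (rule LIMSEQ_le_const[OF tendsto_t_norm_ddf[OF T fg r_lim q(2)]])
       (use rs(2) in \<open>auto intro: less_imp_le\<close>)
  also have "\<dots> \<le> tensor L T f g x"
  proof (rule t_norm_ddf_le_of_below[OF fg tensor_nonneg[OF T L fg']])
    fix a b assume "a < r0" "b < s0"
    then have "L a b < x"
      by (rule LS_less_of_limit[OF LS r_lim q(2) u_lim', rotated]) (use rs(1) in auto)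
    then show "T (f a) (g b) \<le> tensor L T f g x"
      using x by (intro tensor_upper[OF T L fg']) auto
  qed
  finally show False using c(1) by simp
qed

lemma tensor_tendsto_one:
  assumes LS: "cond_LS L"
    and fg: "f \<in> continuous_ddf" "g \<in> continuous_ddf" and y: "y < 1"
  shows "\<exists>u<\<infinity>. y < tensor L T f g u"
proof -
  have fg': "f \<in> ddf" "g \<in> ddf" using fg by (auto simp: continuous_ddf_def)
  obtain a :: "nat \<Rightarrow> ennreal" where a: "\<And>n. a n < \<infinity>" "a \<longlonglongrightarrow> \<infinity>"
    using approx_from_below_dense_linorder[of 0 "\<infinity> :: ennreal"] by auto
  have "T (f \<infinity>) (g \<infinity>) = 1"
    using ddf_D(4)[OF fg'(1)] ddf_D(4)[OF fg'(2)] T_one[OF T L, of 1] by simp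
  then have "(\<lambda>n. T (f (a n)) (g (a n))) \<longlonglongrightarrow> 1"
    using tendsto_t_norm_ddf[OF T fg a(2) a(2)] by simp
  then obtain n where n: "y < T (f (a n)) (g (a n))"
    using order_tendstoD(1)[OF _ y] by (force simp: eventually_sequentially)
  have "L (a n) (a n) < L \<infinity> \<infinity>" using LS a(1) unfolding cond_LS_def by blast
  then have "L (a n) (a n) < \<infinity>" by (simp add: order_less_le_trans)
  then obtain u where u: "L (a n) (a n) < u" "u < \<infinity>" using dense by blast
  then have "T (f (a n)) (g (a n)) \<le> tensor L T f g u"
    by (intro tensor_upper[OF T L fg']) auto
  then show ?thesis using n u(2) by (meson order_less_le_trans)
qed

lemma tensor_in_continuous_ddf:
  assumes "cond_LS L" "f \<in> continuous_ddf" "g \<in> continuous_ddf"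
  shows "tensor L T f g \<in> continuous_ddf"
proof (rule continuous_ddfI)
  show "tensor L T f g \<in> ddf"
    using assms(2,3) by (intro tensor_in_ddf[OF T L]) (auto simp: continuous_ddf_def)
qed (use assms tensor_tendsto_one tensor_right_continuous in blast)+

section \<open>Condition (LS) is necessary\<close>

lemma cond_LS_of_tensor_continuous:
  assumes closed: "\<And>f g. f \<in> continuous_ddf \<Longrightarrow> g \<in> continuous_ddf \<Longrightarrow> tensor L T f g \<in> continuous_ddf"
  shows "cond_LS L"
  unfolding cond_LS_def
proof (intro allI impI, rule ccontr)
  fix x x' y y' :: ennreal
  assume xy: "x < x'" "y < y'" and not_less: "\<not> L x y < L x' y'"
  obtain f where f: "f \<in> continuous_ddf" "\<And>t. t \<le> x \<Longrightarrow> f t = 0" "f x' = 1"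
    using continuous_ddf_ramp[OF xy(1)] by auto
  obtain g where g: "g \<in> continuous_ddf" "\<And>t. t \<le> y \<Longrightarrow> g t = 0" "g y' = 1"
    using continuous_ddf_ramp[OF xy(2)] by auto
  have fg: "f \<in> ddf" "g \<in> ddf" using f(1) g(1) by (auto simp: continuous_ddf_def)
  note rf = ddf_D(1)[OF fg(1)] and rg = ddf_D(1)[OF fg(2)]
  obtain z where z: "tensor L T f g z = 1/2"
    using continuous_ddf_takes_half closed f(1) g(1) by blast
  then have z_fin: "z \<noteq> \<infinity>" using tensor_top[OF T L, of f g] by auto
  show False
  proof (cases "z \<le> L x y")
    case True
    have "tensor L T f g z \<le> 0"
    proof (rule tensor_least[OF T L z_fin])
      fix r s assume "L r s < z"
      then have "L r s < L x y" using True by (rule order_less_le_trans)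
      then have "\<not> (x \<le> r \<and> y \<le> s)" using L_mono[OF T L] by (meson not_le)
      then have "f r = 0 \<or> g s = 0" using f(2) g(2) by (meson linear)
      then show "T (f r) (g s) \<le> 0"
        using T_zero[OF T L] T_comm[OF T L] rf rg by (metis order_refl)
    qed simp
    then show False using z by simp
  next
    case False
    then have "L x' y' < z" using not_less by auto
    then have "T (f x') (g y') \<le> tensor L T f g z"
      using z_fin by (rule tensor_upper[OF T L fg])
    then show False using f(3) g(3) T_one[OF T L, of 1] z by simp
  qed
qed

end

section \<open>The characterization\<close>

theorem theorem4p6:
  fixes T :: "real \<Rightarrow> real \<Rightarrow> real"
    and L :: "ennreal \<Rightarrow> ennreal \<Rightarrow> ennreal"
  assumes "continuous_t_norm T"
    and "right_continuous_t_conorm L"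
  shows "((\<forall>f \<in> continuous_ddf. \<forall>g \<in> continuous_ddf. tensor L T f g \<in> continuous_ddf)
            \<longleftrightarrow> cond_LS L) \<and>
         (cond_LS L \<longrightarrow>
            subsemigroup continuous_ddf (ddf_monoid L T) \<and>
            \<not> submonoid continuous_ddf (ddf_monoid L T) \<and>
            step_ddf 0 1 \<notin> continuous_ddf)"
proof -
  have iff: "(\<forall>f \<in> continuous_ddf. \<forall>g \<in> continuous_ddf. tensor L T f g \<in> continuous_ddf)
      \<longleftrightarrow> cond_LS L"
    using tensor_in_continuous_ddf[OF assms] cond_LS_of_tensor_continuous[OF assms] by blast
  have "subsemigroup continuous_ddf (ddf_monoid L T)" if "cond_LS L"
    using tensor_in_continuous_ddf[OF assms that]
    by unfold_locales (auto simp: ddf_monoid_def continuous_ddf_def)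
  moreover have "\<not> submonoid continuous_ddf (ddf_monoid L T)"
  proof
    assume "submonoid continuous_ddf (ddf_monoid L T)"
    then have "step_ddf 0 1 \<in> continuous_ddf"
      using submonoid.one_closed by (fastforce simp: ddf_monoid_def)
    then show False using step_ddf_one_not_continuous by blast
  qed
  ultimately show ?thesis using iff step_ddf_one_not_continuous by blast
qed

end
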